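(* Let $\Gamma$ be a connected circulant graph with valency $3$ or $4$. Then $\Gamma$ is closed distance magic if and only if $\Gamma$ is isomorphic either to the complete graph $K_4$ or to the complete graph $K_5$.
   Context: All graphs are finite, simple and undirected. For a finite group $G$ and an inverse-closed subset $S\subseteq G$ not containing the identity, the Cayley graph $\mathrm{Cay}(G;S)$ has vertex set $G$, with $g,h$ adjacent iff $h=gs$ for some $s\in S$; its valency is $|S|$. A circulant graph is a Cayley graph $\mathrm{Cay}(G;S)$ with $G$ a finite cyclic group, i.e. $\mathrm{Cay}(\mathbb{Z}_n;S)$ for some $n$ (written additively). For a vertex $u$, the closed neighborhood $N[u]$ consists of $u$ and all its neighbors. A closed distance magic labeling of a graph $\Gamma=(V,E)$ of order $n=|V|$ is a bijection $\ell:V\to\{1,2,\ldots,n\}$ for which there is a positive integer $r$ with $\sum_{x\in N[u]}\ell(x)=r$ for all $u\in V$. A graph is closed distance magic if it admits a closed distance magic labeling. *)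

theory Defs
  imports "HOL-Algebra.Elementary_Groups" "Graph_Theory.Graph_Theory"
begin

text \<open>
  A finite simple undirected graph is represented, as in \<^theory>\<open>Graph_Theory.Digraph\<close>, by a
  finite loop-free symmetric digraph without parallel arcs (locale \<^locale>\<open>graph\<close>): each edge
  corresponds to a pair of opposite arcs. Then \<^const>\<open>connected\<close> and \<^const>\<open>digraph_iso\<close>
  are connectedness and isomorphism of undirected graphs.
\<close>

definition connection_set :: "('a, 'm) monoid_scheme \<Rightarrow> 'a set \<Rightarrow> bool" where
  "connection_set G S \<longleftrightarrow> S \<subseteq> carrier G \<and> \<one>\<^bsub>G\<^esub> \<notin> S \<and> (\<forall>s\<in>S. inv\<^bsub>G\<^esub> s \<in> S)"

definition cayley_graph :: "('a, 'm) monoid_scheme \<Rightarrow> 'a set \<Rightarrow> 'a pair_pre_digraph" where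
  "cayley_graph G S =
     \<lparr> pverts = carrier G,
       parcs = {(g, h). g \<in> carrier G \<and> h \<in> carrier G \<and> (\<exists>s\<in>S. h = g \<otimes>\<^bsub>G\<^esub> s)} \<rparr>"

definition complete_graph :: "nat \<Rightarrow> nat pair_pre_digraph" where
  "complete_graph n =
     \<lparr> pverts = {0..<n}, parcs = {(u, v). u \<in> {0..<n} \<and> v \<in> {0..<n} \<and> u \<noteq> v} \<rparr>"

definition closed_neighborhood :: "('a, 'b) pre_digraph \<Rightarrow> 'a \<Rightarrow> 'a set" where
  "closed_neighborhood \<Gamma> u = insert u {v \<in> verts \<Gamma>. u \<rightarrow>\<^bsub>\<Gamma>\<^esub> v}"

definition closed_distance_magic_labeling :: "('a, 'b) pre_digraph \<Rightarrow> ('a \<Rightarrow> nat) \<Rightarrow> bool" where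
  "closed_distance_magic_labeling \<Gamma> l \<longleftrightarrow>
     bij_betw l (verts \<Gamma>) {1..card (verts \<Gamma>)} \<and>
     (\<exists>r>0. \<forall>u\<in>verts \<Gamma>. (\<Sum>x\<in>closed_neighborhood \<Gamma> u. l x) = r)"

definition closed_distance_magic :: "('a, 'b) pre_digraph \<Rightarrow> bool" where
  "closed_distance_magic \<Gamma> \<longleftrightarrow> (\<exists>l. closed_distance_magic_labeling \<Gamma> l)"

lemma graph_cayley_graph:
  assumes "group G" and "finite (carrier G)" and "connection_set G S"
  shows "graph (with_proj (cayley_graph G S))"
proof -
  interpret group G by fact
  have S: "S \<subseteq> carrier G" "\<one>\<^bsub>G\<^esub> \<notin> S" "\<And>s. s \<in> S \<Longrightarrow> inv\<^bsub>G\<^esub> s \<in> S"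
    using assms(3) by (auto simp: connection_set_def)
  have fin: "finite (parcs (cayley_graph G S))"
    by (rule finite_subset[of _ "carrier G \<times> carrier G"])
      (auto simp: cayley_graph_def assms(2))
  have symm: "sym (parcs (cayley_graph G S))"
  proof (rule symI)
    fix g h assume "(g, h) \<in> parcs (cayley_graph G S)"
    then obtain s where gh: "g \<in> carrier G" "h \<in> carrier G" and s: "s \<in> S" "h = g \<otimes>\<^bsub>G\<^esub> s"
      by (auto simp: cayley_graph_def)
    have "s \<in> carrier G" using s(1) S(1) by blast
    then have "g = h \<otimes>\<^bsub>G\<^esub> inv\<^bsub>G\<^esub> s"
      unfolding s(2) using gh(1) by (simp add: m_assoc)
    moreover have "inv\<^bsub>G\<^esub> s \<in> S" using s(1) by (rule S(3))
    ultimately show "(h, g) \<in> parcs (cayley_graph G S)"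
      using gh unfolding cayley_graph_def by simp blast
  qed
  have noloop: "g \<noteq> g \<otimes>\<^bsub>G\<^esub> s" if "g \<in> carrier G" "s \<in> S" for g s
  proof
    assume eq: "g = g \<otimes>\<^bsub>G\<^esub> s"
    have "s \<in> carrier G" using that(2) S(1) by blast
    then have "s = \<one>\<^bsub>G\<^esub>" using eq l_cancel_one'[OF that(1)] by blast
    with that(2) S(2) show False by blast
  qed
  have "pair_graph (cayley_graph G S)"
  proof unfold_locales
    fix e assume e: "e \<in> parcs (cayley_graph G S)"
    then show "fst e \<in> pverts (cayley_graph G S)" "snd e \<in> pverts (cayley_graph G S)"
      by (simp_all add: cayley_graph_def case_prod_beta)
    obtain s where "fst e \<in> carrier G" "s \<in> S" and s: "snd e = fst e \<otimes>\<^bsub>G\<^esub> s"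
      using e by (auto simp: cayley_graph_def)
    then show "fst e \<noteq> snd e"
      unfolding s by (intro noloop)
  next
    show "finite (pverts (cayley_graph G S))"
      using assms(2) by (simp add: cayley_graph_def)
  qed (use fin symm in \<open>simp_all add: symmetric_def\<close>)
  then show ?thesis
    by (rule pair_graph.pair_graphD_graph)
qed

lemma complete_digraph_complete_graph:
  "complete_digraph n (with_proj (complete_graph n))"
proof -
  have "finite (parcs (complete_graph n))"
    by (rule finite_subset[of _ "{0..<n} \<times> {0..<n}"]) (auto simp: complete_graph_def)
  then have "pair_graph (complete_graph n)"
    by unfold_locales (auto simp: complete_graph_def symmetric_def sym_def)
  then show ?thesis
    using pair_graph.pair_graphD_graph
    by (auto simp: complete_digraph_def complete_graph_def)
qed

text \<open>In a Cayley graph, the cardinality of the connection set is the valency.\<close>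

lemma out_degree_cayley_graph:
  assumes "group G" and "connection_set G S" and "g \<in> carrier G"
  shows "out_degree (with_proj (cayley_graph G S)) g = card S"
proof -
  interpret group G by fact
  have S: "S \<subseteq> carrier G"
    using assms(2) by (auto simp: connection_set_def)
  have "out_arcs (with_proj (cayley_graph G S)) g = (\<lambda>s. (g, g \<otimes>\<^bsub>G\<^esub> s)) ` S"
    using S assms(3) by (auto simp: out_arcs_def cayley_graph_def)
  moreover have "inj_on (\<lambda>s. (g, g \<otimes>\<^bsub>G\<^esub> s)) S"
    using S assms(3) by (auto simp: inj_on_def subset_iff)
  ultimately show ?thesis
    by (simp add: out_degree_def card_image)
qed

end

theory Submission
  imports Defs "HOL-Algebra.Multiplicative_Group" "HOL-Computational_Algebra.Polynomial"
begin

text \<open>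
  Read along powers of a generator, a closed distance magic labeling of a circulant graph of order
  \<open>n\<close> is an \<open>n\<close>-periodic integer function that the operator \<open>\<Sum>\<^sub>s T\<^sup>s\<close>, with \<open>s\<close> ranging over
  \<open>S \<union> {0}\<close> and \<open>T\<close> the unit shift, maps to a constant. In valency 3 this relation
  forces the labeling to be invariant under translation by \<open>4 s\<close> for all \<open>s \<in> S\<close>. In valency 4,
  summing all labels shows that \<open>n\<close> is odd; then the relation is inherited by the doubled
  translations, and the two relations force invariance under translation by \<open>5 s\<close>. As the
  labeling is injective, the elements of \<open>S\<close>, and by connectedness all elements of the group,
  have order dividing \<open>card S + 1\<close>; a cyclic group with this property equals \<open>S \<union> {0}\<close>, so the
  graph is complete.
\<close>

section \<open>Vanishing sums of shifts and the Frobenius map\<close>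

text \<open>The inner binomial coefficients are divisible by \<open>p\<close>. The ring is general
  so that integer polynomials can be inserted.\<close>

lemma prime_dvd_power_sum_diff:
  fixes f :: "'i \<Rightarrow> 'a::comm_ring_1"
  assumes p: "prime p"
  shows "of_nat p dvd (\<Sum>i\<in>A. f i) ^ p - (\<Sum>i\<in>A. f i ^ p)"
proof (induction A rule: infinite_finite_induct)
  case (insert a A)
  have two: "of_nat p dvd (x + y) ^ p - (x ^ p + y ^ p)" for x y :: 'a
  proof -
    have "{..p} = insert 0 (insert p {0<..<p})"
      using prime_gt_0_nat[OF p] by auto
    then have "(x + y) ^ p - (x ^ p + y ^ p)
      = (\<Sum>k\<in>{0<..<p}. of_nat (p choose k) * x ^ k * y ^ (p - k))"
      using prime_gt_0_nat[OF p] by (simp add: binomial_ring)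
    also have "of_nat p dvd \<dots>"
    proof (intro dvd_sum dvd_mult2)
      fix k assume "k \<in> {0<..<p}"
      then have "p dvd p choose k"
        using p by (intro dvd_choose_prime) auto
      then show "of_nat p dvd (of_nat (p choose k) :: 'a)"
        by (auto elim!: dvdE)
    qed
    finally show ?thesis .
  qed
  have "of_nat p dvd ((f a + sum f A) ^ p - (f a ^ p + sum f A ^ p))
      + (sum f A ^ p - (\<Sum>i\<in>A. f i ^ p))"
    by (intro dvd_add two insert.IH)
  then show ?case using insert.hyps by (simp add: algebra_simps)
qed (use prime_gt_0_nat[OF p] in \<open>simp_all add: power_0_left\<close>)

text \<open>Makes sequences a module over the polynomial ring, the indeterminate acting as the unit
  shift; products then act by composition.\<close>

definition shift_action :: "'a::comm_ring_1 poly \<Rightarrow> (nat \<Rightarrow> 'a) \<Rightarrow> nat \<Rightarrow> 'a" where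
  "shift_action P f x = (\<Sum>i\<le>degree P. coeff P i * f (x + i))"

lemma shift_action_0 [simp]: "shift_action 0 f x = 0"
  by (simp add: shift_action_def)

lemma shift_action_zero_fun [simp]: "shift_action P (\<lambda>_. 0) x = 0"
  by (simp add: shift_action_def)

lemma shift_action_pCons [simp]:
  "shift_action (pCons c P) f x = c * f x + shift_action P f (Suc x)"
  by (cases "P = 0") (simp_all add: shift_action_def sum.atMost_Suc_shift del: sum.atMost_Suc)

lemma shift_action_add: "shift_action (P + Q) f x = shift_action P f x + shift_action Q f x"
  by (induction P Q arbitrary: x rule: poly_induct2) (simp_all add: algebra_simps)

lemma shift_action_smult: "shift_action (smult c P) f x = c * shift_action P f x"
  by (induction P arbitrary: x) (simp_all add: algebra_simps)

lemma shift_action_sum: "shift_action (\<Sum>i\<in>A. P i) f x = (\<Sum>i\<in>A. shift_action (P i) f x)"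
  by (induction A rule: infinite_finite_induct) (simp_all add: shift_action_add)

lemma shift_action_monom: "shift_action (monom c k) f x = c * f (x + k)"
  by (induction k arbitrary: x) (simp_all add: monom_0 monom_Suc)

lemma shift_action_mult: "shift_action (P * Q) f x = shift_action P (shift_action Q f) x"
  by (induction P arbitrary: x) (simp_all add: shift_action_add shift_action_smult)

text \<open>Frobenius: \<open>P\<^sup>p\<close> annihilates \<open>f\<close> and is congruent modulo \<open>p\<close> to the polynomial with
  exponents multiplied by \<open>p\<close>, so the new sum is divisible by \<open>p\<close>, but smaller than \<open>p\<close>.\<close>

lemma zero_sum_prime_multiple:
  fixes f :: "nat \<Rightarrow> int" and e :: "'w \<Rightarrow> nat"
  assumes p: "prime p" and bound: "\<And>x. \<bar>f x\<bar> \<le> B" and large: "int (card W) * B < int p"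
    and zero: "\<And>x. (\<Sum>w\<in>W. f (x + e w)) = 0"
  shows "(\<Sum>w\<in>W. f (x + p * e w)) = 0"
proof -
  define P :: "int poly" where "P = (\<Sum>w\<in>W. monom 1 (e w))"
  have "shift_action P f = (\<lambda>_. 0)"
    using zero by (simp add: P_def shift_action_sum shift_action_monom fun_eq_iff)
  \<comment> \<open>The last factor is split off because the right factor acts on \<open>f\<close>
    first.\<close>
  moreover have "P ^ p = P ^ (p - 1) * P"
    using prime_gt_0_nat[OF p] by (simp flip: power_Suc2)
  ultimately have act0: "shift_action (P ^ p) f x = 0"
    by (simp add: shift_action_mult)
  have "of_nat p dvd P ^ p - (\<Sum>w\<in>W. monom 1 (e w) ^ p)"
    unfolding P_def by (rule prime_dvd_power_sum_diff[OF p])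
  then obtain Q where "P ^ p - (\<Sum>w\<in>W. monom 1 (e w) ^ p) = of_nat p * Q" ..
  then have "P ^ p = (\<Sum>w\<in>W. monom 1 (p * e w)) + smult (int p) Q"
    by (simp add: monom_power of_nat_poly algebra_simps)
  then have "(\<Sum>w\<in>W. f (x + p * e w)) = - int p * shift_action Q f x"
    using act0 by (simp add: shift_action_add shift_action_sum shift_action_monom shift_action_smult)
  then have "int p dvd (\<Sum>w\<in>W. f (x + p * e w))" by simp
  moreover have "\<bar>\<Sum>w\<in>W. f (x + p * e w)\<bar> \<le> int (card W) * B"
    using sum_bounded_above[of W "\<lambda>w. \<bar>f (x + p * e w)\<bar>" B] bound
    by (intro order_trans[OF sum_abs]) simp
  ultimately show ?thesis
    using large zdvd_not_zless[of "\<bar>\<Sum>w\<in>W. f (x + p * e w)\<bar>" "int p"] by fastforce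
qed

text \<open>One prime factor is treated at a time, the shifts being already scaled by the cofactor.
  \<open>B\<close> and \<open>W\<close> do not change, so one threshold serves all primes.\<close>

lemma zero_sum_multiple_large_prime_factors:
  fixes f :: "nat \<Rightarrow> int" and e :: "'w \<Rightarrow> nat"
  assumes "m > 0" and "\<And>x. \<bar>f x\<bar> \<le> B"
    and "\<And>p. prime p \<Longrightarrow> p dvd m \<Longrightarrow> int (card W) * B < int p"
    and "\<And>x. (\<Sum>w\<in>W. f (x + e w)) = 0"
  shows "(\<Sum>w\<in>W. f (x + m * e w)) = 0"
  using assms(1,3)
proof (induction m arbitrary: x rule: prime_divisors_induct)
  case (factor p m)
  have "(\<Sum>w\<in>W. f (x + p * (m * e w))) = 0"
    using factor assms(2) by (intro zero_sum_prime_multiple[where B = B and e = "\<lambda>w. m * e w"]) auto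
  then show ?case by (simp add: mult.assoc)
next
  case (unit m)
  then show ?case using assms(4) by simp
qed simp

text \<open>Supplies, in the residue class of \<open>q\<close>, a multiplier that is reached through
  primes beyond the threshold of the Frobenius step.\<close>

lemma coprime_cong_large_prime_factors:
  fixes n q b :: nat
  assumes "coprime q n"
  obtains t where "t > 0" "\<And>p. prime p \<Longrightarrow> p dvd q + n * t \<Longrightarrow> b < p"
proof -
  \<comment> \<open>A prime up to \<open>b\<close> that divides \<open>q\<close> divides neither
    \<open>n\<close> nor \<open>t\<close>; one that does not divide \<open>q\<close> divides
    \<open>t\<close>. Either way it cannot divide \<open>q + n * t\<close>.\<close>
  define t where "t = \<Prod>{p. prime p \<and> p \<le> b \<and> \<not> p dvd q}"
  have fin: "finite {p. prime p \<and> p \<le> b \<and> \<not> p dvd q}"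
    by (rule finite_subset[of _ "{..b}"]) auto
  have "b < p" if p: "prime p" "p dvd q + n * t" for p
  proof (rule ccontr)
    assume "\<not> b < p"
    show False
    proof (cases "p dvd q")
      case True
      with p have "p dvd n \<or> p dvd t"
        by (metis dvd_add_right_iff prime_dvd_mult_iff)
      moreover have "\<not> p dvd n"
        using assms p(1) True coprime_common_divisor not_prime_unit by blast
      moreover have "\<not> p dvd t"
        unfolding t_def
      proof
        assume "p dvd \<Prod>{p. prime p \<and> p \<le> b \<and> \<not> p dvd q}"
        then obtain r where "prime r" "\<not> r dvd q" "p dvd r"
          using prime_dvd_prod_iff[OF fin p(1), of "\<lambda>x. x"] by auto
        with p(1) True show False by (metis primes_dvd_imp_eq)
      qed
      ultimately show False by blast
    next
      case False
      with \<open>\<not> b < p\<close> p(1) have "p dvd t"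
        unfolding t_def using fin by (intro dvd_prodI) auto
      with p(2) False show False by (metis dvd_add_left_iff dvd_mult)
    qed
  qed
  moreover have "t > 0"
    unfolding t_def by (intro prod_pos) (auto simp: prime_gt_0_nat)
  ultimately show thesis using that by blast
qed

text \<open>An elementary form of Galois conjugation: it says that the automorphism \<open>\<zeta> \<mapsto> \<zeta>\<^sup>q\<close> of the
  \<open>n\<close>-th roots of unity preserves vanishing sums. By periodicity \<open>q\<close> may be replaced with a
  number \<open>q + n t\<close> all of whose prime factors are large.\<close>

lemma zero_sum_coprime_multiple:
  fixes f :: "nat \<Rightarrow> int" and e :: "'w \<Rightarrow> nat"
  assumes n: "n > 0" and period: "\<And>x. f (x + n) = f x" and q: "coprime q n"
    and zero: "\<And>x. (\<Sum>w\<in>W. f (x + e w)) = 0"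
  shows "(\<Sum>w\<in>W. f (x + q * e w)) = 0"
proof -
  have periods: "f (x + n * k) = f x" for x k
    by (induction k) (simp_all add: period flip: add.assoc add.commute[of "_ * _" n])
  \<comment> \<open>A periodic sequence takes all its values within one period, so this sum bounds
    them.\<close>
  define B where "B = (\<Sum>k<n. \<bar>f k\<bar>)"
  have bound: "\<bar>f x\<bar> \<le> B" for x
  proof -
    have "\<bar>f x\<bar> = \<bar>f (x mod n)\<bar>"
      using periods[of "x mod n" "x div n"] by simp
    also have "\<dots> \<le> B"
      unfolding B_def using n by (intro member_le_sum) auto
    finally show ?thesis .
  qed
  obtain t where t: "t > 0" "\<And>p. prime p \<Longrightarrow> p dvd q + n * t \<Longrightarrow> nat (int (card W) * B) < p"
    using coprime_cong_large_prime_factors[OF q] by blast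
  have "int (card W) * B < int p" if "prime p" "p dvd q + n * t" for p
    using t(2)[OF that] by linarith
  then have "(\<Sum>w\<in>W. f (x + (q + n * t) * e w)) = 0"
    using n t(1) bound zero
    by (intro zero_sum_multiple_large_prime_factors[where B = B]) auto
  moreover have "f (x + (q + n * t) * e w) = f (x + q * e w)" for w
    using periods[of "x + q * e w" "t * e w"] by (simp add: algebra_simps)
  ultimately show ?thesis by simp
qed

section \<open>Periodicity from the relations of valency 3 and 4\<close>

text \<open>With \<open>T\<close> the shift by \<open>i\<close>, the two parts of \<open>F\<close> that are odd and even under the shift
  by \<open>j\<close> satisfy \<open>(T\<^sup>2 + 1) D = 0\<close> and \<open>(T + 1)\<^sup>2 E = 0\<close>. By the latter, \<open>E\<close> is up to
  alternating signs affine along multiples of \<open>i\<close>, so that periodicity forces \<open>(T + 1) E = 0\<close>.\<close>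

lemma periodic_of_valency_3_sum:
  fixes F :: "nat \<Rightarrow> int"
  assumes n: "n > 0" and period: "\<And>x. F (x + n) = F x"
    and inv: "\<And>x. F (x + i + i') = F x" and invol: "\<And>x. F (x + 2 * j) = F x"
    and sum: "\<And>x. F x + F (x + i) + F (x + i') + F (x + j) = r"
  shows "F (x + 4 * i) = F x"
proof -
  have multiples: "2 * k = k + k" "3 * k = k + k + k" "4 * k = k + k + k + k"
    "5 * k = k + k + k + k + k" for k :: nat
    by simp_all
  define D where "D x = F x - F (x + j)" for x
  \<comment> \<open>Doubling and subtracting \<open>r\<close> removes the constant from the relation
    without leaving the integers.\<close>
  define E where "E x = 2 * (F x + F (x + j)) - r" for x
  have sum1: "F (x + i) + F (x + 2 * i) + F x + F (x + i + j) = r" for x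
    using sum[of "x + i"] inv[of x] by (simp add: add_ac multiples)
  have sum2: "F (x + i + j) + F (x + 2 * i + j) + F (x + j) + F (x + i) = r" for x
    using sum1[of "x + j"] invol[of "x + i"] by (simp add: add_ac multiples)
  have D2: "D (x + 2 * i) = - D x" for x
    using sum1[of x] sum2[of x] by (simp add: D_def add_ac multiples)
  have E2: "E (x + 2 * i) = - E x - 2 * E (x + i)" for x
    using sum1[of x] sum2[of x] by (simp add: E_def add_ac multiples)
  have affine: "E (x + 2 * k * i) = E x - int k * (2 * (E x + E (x + i)))
      \<and> E (x + 2 * k * i + i) = E (x + i) + int k * (2 * (E x + E (x + i)))" for k x
  proof (induction k)
    case (Suc k)
    define y where "y = x + 2 * k * i"
    have "x + 2 * Suc k * i = y + 2 * i" "x + 2 * Suc k * i + i = y + i + 2 * i"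
      "y + i + i = y + 2 * i"
      by (simp_all add: y_def)
    then have "E (x + 2 * Suc k * i) = - E y - 2 * E (y + i)"
      and "E (x + 2 * Suc k * i + i) = 2 * E y + 3 * E (y + i)"
      using E2[of y] E2[of "y + i"] by (simp_all only:) simp
    then show ?case
      using Suc unfolding y_def[symmetric]
      by (simp only: of_nat_Suc) (simp add: distrib_right distrib_left)
  qed simp
  have periods: "F (x + n * k) = F x" for x k
    by (induction k) (simp_all add: period flip: add.assoc add.commute[of "_ * _" n])
  \<comment> \<open>The shift \<open>2 * n * i\<close> is a multiple of the period, so the increment
    in \<open>affine\<close> vanishes for \<open>k = n\<close>.\<close>
  have "E (x + 2 * n * i) = E x" for x
    using periods[of x "2 * i"] periods[of "x + j" "2 * i"]
    by (simp add: E_def add_ac mult.left_commute mult.assoc)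
  with affine[of _ n] have "int n * (2 * (E x + E (x + i))) = 0" for x
    by simp
  with n have "E x + E (x + i) = 0" for x
    by (metis mult_eq_0_iff of_nat_0_less_iff less_irrefl zero_neq_numeral)
  then have "E (x + 2 * i) = E x" for x
    using E2[of x] by (simp add: add_eq_0_iff)
  from this[of x] this[of "x + 2 * i"] D2[of x] D2[of "x + 2 * i"]
  have "E (x + 4 * i) = E x" "D (x + 4 * i) = D x"
    by (simp_all add: add_ac multiples)
  \<comment> \<open>\<open>F\<close> is recovered from 2 D + E = 4 F - r.\<close>
  then show ?thesis by (simp add: D_def E_def)
qed

text \<open>Let \<open>X = T + T\<^sup>-\<^sup>1\<close> and \<open>Y = U + U\<^sup>-\<^sup>1\<close> for the shifts \<open>T\<close>, \<open>U\<close> by \<open>i\<close>, \<open>j\<close>. The hypothesis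
  \<open>(1 + X + Y) f = 0\<close> survives doubling of the shifts, as \<open>(X\<^sup>2 + Y\<^sup>2 - 3) f = 0\<close>. Eliminating
  \<open>Y\<close> gives \<open>(X\<^sup>2 + X - 1) f = 0\<close>, that is \<open>(1 + T + \<dots> + T\<^sup>4) f = 0\<close>.\<close>

lemma periodic_of_valency_4_sum:
  fixes f :: "nat \<Rightarrow> int"
  assumes n: "odd n" and period: "\<And>x. f (x + n) = f x"
    and inv: "\<And>x. f (x + i + i') = f x" "\<And>x. f (x + j + j') = f x"
    and sum: "\<And>x. f x + f (x + i) + f (x + i') + f (x + j) + f (x + j') = 0"
  shows "f (x + 5 * i) = f x"
proof -
  have multiples: "2 * k = k + k" "3 * k = k + k + k" "4 * k = k + k + k + k"
    "5 * k = k + k + k + k + k" for k :: nat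
    by simp_all
  \<comment> \<open>The entry 0 stands for the vertex itself. Indexing by position counts coinciding
    shifts separately.\<close>
  define e where "e = (!) [0, i, i', j, j']"
  have double_e: "(\<Sum>w<5. f (x + 2 * e w)) = 0" for x
  proof (rule zero_sum_coprime_multiple[where f = f and n = n])
    show "(\<Sum>w<5. f (x + e w)) = 0" for x
      using sum[of x] by (simp add: e_def eval_nat_numeral)
  qed (use n in \<open>auto intro: odd_pos simp: period\<close>)
  then have double: "f x + f (x + 2 * i) + f (x + 2 * i') + f (x + 2 * j) + f (x + 2 * j') = 0" for x
    using double_e[of x] by (simp add: e_def eval_nat_numeral)
  \<comment> \<open>The combination is X^2 + Y^2 - 3 - (Y - X - 1)(1 + X + Y) = 2 (X^2 + X - 1), and
    the factor 2 cancels.\<close>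
  have quintic: "f x + f (x + i) + f (x + i') + f (x + 2 * i) + f (x + 2 * i') = 0" for x
    using sum[of x] sum[of "x + i"] sum[of "x + i'"] sum[of "x + j"] sum[of "x + j'"]
      double[of x] inv[of x]
    by (simp add: add_ac multiples)
  \<comment> \<open>Two overlapping windows of five terms with zero sum differ only in their end
    terms.\<close>
  have "f (x + 3 * i) = f (x + 2 * i')" for x
    using quintic[of x] quintic[of "x + i"] inv(1)[of x] inv(1)[of "x + i'"]
    by (simp add: add_ac multiples)
  from this[of "x + 2 * i"] show ?thesis
    using inv(1)[of x] inv(1)[of "x + i + i'"] by (simp add: add_ac multiples)
qed

section \<open>Neighborhood sums in Cayley graphs\<close>

lemma closed_neighborhood_cayley_graph:
  assumes "group G" "S \<subseteq> carrier G" "u \<in> carrier G"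
  shows "closed_neighborhood (with_proj (cayley_graph G S)) u = (\<lambda>s. u \<otimes>\<^bsub>G\<^esub> s) ` insert \<one>\<^bsub>G\<^esub> S"
proof -
  interpret group G by fact
  show ?thesis
    using assms(2,3) by (auto simp: closed_neighborhood_def cayley_graph_def arcs_ends_def)
qed

lemma sum_closed_neighborhood_cayley_graph:
  assumes "group G" "S \<subseteq> carrier G" "u \<in> carrier G"
  shows "(\<Sum>x\<in>closed_neighborhood (with_proj (cayley_graph G S)) u. l x)
    = (\<Sum>s\<in>insert \<one>\<^bsub>G\<^esub> S. l (u \<otimes>\<^bsub>G\<^esub> s))"
proof -
  interpret group G by fact
  have "inj_on (\<lambda>s. u \<otimes>\<^bsub>G\<^esub> s) (insert \<one>\<^bsub>G\<^esub> S)"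
    using assms(2,3) by (intro inj_on_subset[OF inj_on_cmult]) auto
  then show ?thesis
    unfolding closed_neighborhood_cayley_graph[OF assms] by (rule sum.reindex_cong) simp_all
qed

text \<open>Double counting: right translation by each \<open>s\<close> permutes the group, so each
  \<open>s\<close> contributes the full label sum.\<close>

lemma (in group) constant_translate_sum:
  fixes l :: "'a \<Rightarrow> nat"
  assumes fin: "finite (carrier G)" and W: "W \<subseteq> carrier G"
    and const: "\<And>u. u \<in> carrier G \<Longrightarrow> (\<Sum>s\<in>W. l (u \<otimes> s)) = r"
  shows "card (carrier G) * r = card W * (\<Sum>u\<in>carrier G. l u)"
proof -
  have translate: "(\<Sum>u\<in>carrier G. l (u \<otimes> s)) = (\<Sum>u\<in>carrier G. l u)" if "s \<in> W" for s
  proof -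
    have s: "s \<in> carrier G" using that W by blast
    then have "bij_betw (\<lambda>u. u \<otimes> s) (carrier G) (carrier G)"
      by (intro bij_betw_byWitness[where f' = "\<lambda>u. u \<otimes> inv s"]) (auto simp: m_assoc)
    then show ?thesis by (rule sum.reindex_bij_betw)
  qed
  have "card (carrier G) * r = (\<Sum>u\<in>carrier G. \<Sum>s\<in>W. l (u \<otimes> s))"
    using const by simp
  also have "\<dots> = (\<Sum>s\<in>W. \<Sum>u\<in>carrier G. l (u \<otimes> s))" by (rule sum.swap)
  also have "\<dots> = card W * (\<Sum>u\<in>carrier G. l u)"
    by (simp add: translate)
  finally show ?thesis .
qed

section \<open>Cyclic groups and small connection sets\<close>

text \<open>Natural exponents let a labeling be read as a sequence on \<open>nat\<close>; the bound
  \<open>ord g\<close> serves to locate involutions and to bound the group order.\<close>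

lemma (in group) finite_cyclic_generator:
  assumes "cyclic_group G" "finite (carrier G)"
  obtains g where "g \<in> carrier G" "\<And>x. x \<in> carrier G \<Longrightarrow> \<exists>i<ord g. x = g [^] (i::nat)"
proof -
  obtain g where g: "g \<in> carrier G" and range: "carrier G = range (\<lambda>n::int. g [^] n)"
    using assms(1) by (auto simp: cyclic_group)
  have pos: "ord g > 0" using ord_ge_1[OF assms(2) g] by simp
  have "\<exists>i<ord g. x = g [^] i" if x: "x \<in> carrier G" for x
  proof -
    obtain z :: int where z: "x = g [^] z" using x range by auto
    define i where "i = nat (z mod int (ord g))"
    have "int i = z mod int (ord g)" using pos by (simp add: i_def)
    then have "int (ord g) dvd z - int i" by (simp add: dvd_minus_mod)
    then have "g [^] int i = g [^] z" using g by (simp add: int_pow_eq)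
    moreover have "i < ord g" using pos by (simp add: i_def nat_less_iff)
    ultimately show ?thesis using z by (auto simp: int_pow_int)
  qed
  then show thesis using that g by blast
qed

lemma (in group) cyclic_involution_unique:
  assumes "cyclic_group G" "finite (carrier G)"
    and x: "x \<in> carrier G" "x \<noteq> \<one>" "x \<otimes> x = \<one>" and y: "y \<in> carrier G" "y \<noteq> \<one>" "y \<otimes> y = \<one>"
  shows "x = y"
proof -
  obtain g where g: "g \<in> carrier G" and gen: "\<And>x. x \<in> carrier G \<Longrightarrow> \<exists>i<ord g. x = g [^] (i::nat)"
    using finite_cyclic_generator assms(1,2) by blast
  \<comment> \<open>\<open>ord g\<close> divides \<open>2 * i\<close>, which lies strictly between 0
    and \<open>2 * ord g\<close>.\<close>
  have half: "2 * i = ord g" if "i < ord g" "g [^] i \<noteq> \<one>" "g [^] i \<otimes> g [^] i = \<one>" for i :: nat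
  proof -
    have "ord g dvd i + i" using that(3) g by (simp add: nat_pow_mult pow_eq_id)
    moreover have "i > 0" using that(2) by (cases i) auto
    ultimately obtain k where k: "2 * i = ord g * k" "0 < ord g * k"
      by (metis dvdE mult_2 nat_0_less_mult_iff zero_less_numeral)
    then have "ord g * k < ord g * 2" using that(1) k(1) by linarith
    then have "k < 2" by (simp only: nat_mult_less_cancel_disj)
    moreover from k(2) have "k > 0" by simp
    ultimately show ?thesis using k(1) by (simp add: less_2_cases_iff)
  qed
  obtain i j where i: "i < ord g" "x = g [^] i" and j: "j < ord g" "y = g [^] j"
    using gen x(1) y(1) by meson
  then have "2 * i = 2 * j" using half[of i] half[of j] x y by simp
  then show ?thesis using i j by simp
qed

text \<open>A cyclic group has at most one involution, so some pair \<open>a\<close>,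
  \<open>inv a\<close> of distinct elements splits off; the remaining element must be its own
  inverse. The Klein four-group shows that cyclicity matters.\<close>

lemma (in group) connection_set_card_3:
  assumes cyc: "cyclic_group G" and fin: "finite (carrier G)"
    and S: "connection_set G S" "card S = 3"
  obtains a h where "S = {a, inv a, h}" "h \<otimes> h = \<one>"
proof -
  have SG: "S \<subseteq> carrier G" and S1: "\<one> \<notin> S" and Sinv: "\<And>s. s \<in> S \<Longrightarrow> inv s \<in> S"
    using S(1) by (auto simp: connection_set_def)
  have finS: "finite S" using S(2) by (simp add: card_ge_0_finite)
  have selfinv: "s \<otimes> s = \<one> \<longleftrightarrow> inv s = s" if "s \<in> carrier G" for s
    using that by (metis inv_equality r_inv)
  have "\<not> S \<subseteq> {s}" for s
    using S(2) card_mono[of "{s}" S] by auto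
  then obtain a where a: "a \<in> S" "inv a \<noteq> a"
  proof -
    obtain s where s: "s \<in> S" using S(2) by fastforce
    have "\<exists>a\<in>S. inv a \<noteq> a"
    proof (rule ccontr)
      assume "\<not> (\<exists>a\<in>S. inv a \<noteq> a)"
      then have "a \<in> carrier G \<and> a \<noteq> \<one> \<and> a \<otimes> a = \<one>" if "a \<in> S" for a
        using that SG S1 selfinv by blast
      then have "a = s" if "a \<in> S" for a
        using that s cyclic_involution_unique[OF cyc fin] by blast
      with \<open>\<not> S \<subseteq> {s}\<close> show False by blast
    qed
    then show thesis using that by blast
  qed
  have "card (S - {a, inv a}) = 1"
    using a S(2) Sinv[of a] finS by (simp add: card_Diff_subset)
  then obtain h where h: "S - {a, inv a} = {h}" by (auto simp: card_1_singleton_iff)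
  then have hS: "h \<in> S" "h \<noteq> a" "h \<noteq> inv a" by auto
  have "inv h \<noteq> a" "inv h \<noteq> inv a"
    using hS a SG by (metis inv_inv subsetD)+
  with h Sinv[OF hS(1)] have "inv h = h" by auto
  then have "h \<otimes> h = \<one>" using selfinv[of h] hS(1) SG by auto
  moreover have "S = {a, inv a, h}" using h a(1) Sinv[OF a(1)] by auto
  ultimately show thesis using that by blast
qed

text \<open>Inversion has no fixed point on \<open>S\<close>, so it splits \<open>S\<close> into two
  pairs.\<close>

lemma (in group) connection_set_card_4:
  assumes S: "connection_set G S" "card S = 4"
    and noinvol: "\<And>s. s \<in> S \<Longrightarrow> s \<otimes> s \<noteq> \<one>"
  obtains a b where "S = {a, inv a, b, inv b}"
proof -
  have SG: "S \<subseteq> carrier G" and Sinv: "\<And>s. s \<in> S \<Longrightarrow> inv s \<in> S"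
    using S(1) by (auto simp: connection_set_def)
  have finS: "finite S" using S(2) by (simp add: card_ge_0_finite)
  have neq: "inv s \<noteq> s" if "s \<in> S" for s
    using that noinvol SG by (metis r_inv subsetD)
  obtain a where a: "a \<in> S" using S(2) by fastforce
  have "card (S - {a, inv a}) = 2"
    using a S(2) Sinv[of a] finS neq[OF a] by (simp add: card_Diff_subset)
  then have "S - {a, inv a} \<noteq> {}" by (metis card.empty zero_neq_numeral)
  then obtain b where b: "b \<in> S" "b \<noteq> a" "b \<noteq> inv a" by blast
  have "inv b \<noteq> a" "inv b \<noteq> inv a"
    using b a SG by (metis inv_inv subsetD)+
  then have "card {a, inv a, b, inv b} = 4"
    using b neq[OF a] neq[OF b(1)] by auto
  then have "S = {a, inv a, b, inv b}"
    using S(2) a b(1) Sinv finS by (intro card_subset_eq[symmetric]) auto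
  then show thesis by (rule that)
qed

section \<open>The exponent of the group\<close>

text \<open>Labels along the powers of a generator satisfy the sequence relation. Periodicity at 0
  gives the fourth power of \<open>a\<close> and the identity the same label, and \<open>l\<close>
  is injective.\<close>

lemma (in group) pow_4_of_valency_3_sum:
  fixes l :: "'a \<Rightarrow> nat"
  assumes cyc: "cyclic_group G" "finite (carrier G)" and inj: "inj_on l (carrier G)"
    and a: "a \<in> carrier G" and h: "h \<in> carrier G" "h \<otimes> h = \<one>"
    and sum: "\<And>u. u \<in> carrier G \<Longrightarrow> l u + l (u \<otimes> a) + l (u \<otimes> inv a) + l (u \<otimes> h) = r"
  shows "a [^] (4::nat) = \<one>"
proof -
  obtain g where g: "g \<in> carrier G" and gen: "\<And>x. x \<in> carrier G \<Longrightarrow> \<exists>i<ord g. x = g [^] (i::nat)"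
    using finite_cyclic_generator[OF cyc] by blast
  obtain i i' j where i: "a = g [^] (i::nat)" and i': "inv a = g [^] (i'::nat)" and j: "h = g [^] (j::nat)"
    using gen[OF a] gen[OF inv_closed[OF a]] gen[OF h(1)] by blast
  define F where "F k = int (l (g [^] k))" for k :: nat
  have pow_add: "g [^] (x + y) = g [^] x \<otimes> g [^] y" for x y :: nat
    using g by (simp add: nat_pow_mult)
  have "F (0 + 4 * i) = F 0"
  proof (rule periodic_of_valency_3_sum[where n = "ord g" and i' = i' and j = j])
    show "ord g > 0" using ord_ge_1[OF cyc(2) g] by simp
    show "F (x + ord g) = F x" for x
      using g by (simp add: F_def pow_add)
    show "F (x + i + i') = F x" for x
      using g a by (simp add: F_def pow_add m_assoc flip: i i')
    show "F (x + 2 * j) = F x" for x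
      using g h by (simp add: F_def pow_add m_assoc mult_2 flip: j)
    show "F x + F (x + i) + F (x + i') + F (x + j) = int r" for x
      using sum[of "g [^] x"] g by (simp add: F_def pow_add flip: i i' j)
  qed
  then have "g [^] (4 * i) = g [^] (0::nat)"
    using inj g by (auto simp: F_def inj_on_def)
  then show ?thesis
    using g by (simp add: i nat_pow_pow mult.commute)
qed

lemma (in group) pow_5_of_valency_4_sum:
  fixes l :: "'a \<Rightarrow> nat"
  assumes cyc: "cyclic_group G" "finite (carrier G)" and odd: "odd (card (carrier G))"
    and inj: "inj_on l (carrier G)" and a: "a \<in> carrier G" and b: "b \<in> carrier G"
    and sum: "\<And>u. u \<in> carrier G \<Longrightarrow>
      l u + l (u \<otimes> a) + l (u \<otimes> inv a) + l (u \<otimes> b) + l (u \<otimes> inv b) = r"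
    and mean: "2 * r = 5 * (card (carrier G) + 1)"
  shows "a [^] (5::nat) = \<one>"
proof -
  obtain g where g: "g \<in> carrier G" and gen: "\<And>x. x \<in> carrier G \<Longrightarrow> \<exists>i<ord g. x = g [^] (i::nat)"
    using finite_cyclic_generator[OF cyc] by blast
  obtain i i' j j' where i: "a = g [^] (i::nat)" and i': "inv a = g [^] (i'::nat)"
    and j: "b = g [^] (j::nat)" and j': "inv b = g [^] (j'::nat)"
    using gen[OF a] gen[OF inv_closed[OF a]] gen[OF b] gen[OF inv_closed[OF b]] by blast
  define n where "n = card (carrier G)"
  \<comment> \<open>By \<open>mean\<close>, (n + 1) / 2 is the average label in each closed
    neighborhood. Twice the deviation from it is an integer and has zero neighborhood sums.\<close>
  define F where "F k = 2 * int (l (g [^] k)) - int (n + 1)" for k :: nat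
  have pow_add: "g [^] (x + y) = g [^] x \<otimes> g [^] y" for x y :: nat
    using g by (simp add: nat_pow_mult)
  have "F (0 + 5 * i) = F 0"
  proof (rule periodic_of_valency_4_sum[where n = n and i' = i' and j = j and j' = j'])
    show "odd n" using odd by (simp add: n_def)
    show "F (x + n) = F x" for x
      using g pow_order_eq_1[OF g] by (simp add: F_def pow_add n_def Coset.order_def)
    show "F (x + i + i') = F x" for x
      using g a by (simp add: F_def pow_add m_assoc flip: i i')
    show "F (x + j + j') = F x" for x
      using g b by (simp add: F_def pow_add m_assoc flip: j j')
    show "F x + F (x + i) + F (x + i') + F (x + j) + F (x + j') = 0" for x
      using sum[of "g [^] x"] g mean by (simp add: F_def pow_add n_def flip: i i' j j')
  qed
  then have "g [^] (5 * i) = g [^] (0::nat)"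
    using inj g by (auto simp: F_def inj_on_def)
  then show ?thesis
    using g by (simp add: i nat_pow_pow mult.commute)
qed

text \<open>Commutativity makes \<open>k\<close>-th powers multiplicative, so they are constant
  along arcs and hence along paths from the identity.\<close>

lemma (in comm_group) pow_eq_one_of_connected_cayley_graph:
  fixes k :: nat
  assumes S: "connection_set G S" and pow: "\<And>s. s \<in> S \<Longrightarrow> s [^] k = \<one>"
    and conn: "connected (with_proj (cayley_graph G S))" and x: "x \<in> carrier G"
  shows "x [^] k = \<one>"
proof -
  have SG: "S \<subseteq> carrier G" using S by (simp add: connection_set_def)
  have pow_arc: "y [^] k = x [^] k" if "(x, y) \<in> parcs (cayley_graph G S)" for x y
    using that SG pow by (auto simp: cayley_graph_def pow_mult_distrib m_comm)
  \<comment> \<open>\<open>connected\<close> means reachability in the symmetric closure, so the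
    induction meets arcs of both orientations.\<close>
  have "wf_digraph (with_proj (cayley_graph G S))"
    by (rule wf_digraph.intro) (auto simp: cayley_graph_def)
  then interpret sym: pair_wf_digraph "mk_symmetric (with_proj (cayley_graph G S))"
    by (rule wf_digraph.wellformed_mk_symmetric)
  have "\<one> \<rightarrow>\<^sup>*\<^bsub>with_proj (mk_symmetric (with_proj (cayley_graph G S)))\<^esub> x"
    using conn x by (auto simp: connected_def strongly_connected_def cayley_graph_def)
  then show ?thesis
  proof (induction rule: sym.reachable_induct)
    case (step y z)
    then have "(y, z) \<in> parcs (cayley_graph G S) \<or> (z, y) \<in> parcs (cayley_graph G S)"
      by (auto simp: mk_symmetric_def symcl_def arcs_ends_def)
    with step.IH show ?case using pow_arc by metis
  qed simp
qed

lemma (in group) card_cyclic_le_exponent: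
  fixes k :: nat
  assumes "cyclic_group G" "finite (carrier G)" "k > 0"
    and "\<And>x. x \<in> carrier G \<Longrightarrow> x [^] k = \<one>"
  shows "card (carrier G) \<le> k"
proof -
  obtain g where g: "g \<in> carrier G" and gen: "\<And>x. x \<in> carrier G \<Longrightarrow> \<exists>i<ord g. x = g [^] (i::nat)"
    using finite_cyclic_generator[OF assms(1,2)] by blast
  have "card (carrier G) \<le> card ((\<lambda>i::nat. g [^] i) ` {..<ord g})"
    using gen by (intro card_mono) auto
  also have "\<dots> \<le> ord g" using card_image_le[of "{..<ord g}"] by simp
  also have "ord g \<le> k"
    using assms(3,4) g by (intro dvd_imp_le) (simp_all add: pow_eq_id flip: pow_eq_id)
  finally show ?thesis .
qed

section \<open>Complete graphs\<close>

lemma digraph_iso_complete_graph: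
  fixes \<Gamma> :: "'a pair_pre_digraph"
  assumes fin: "finite (pverts \<Gamma>)"
    and arcs: "parcs \<Gamma> = {(u, v). u \<in> pverts \<Gamma> \<and> v \<in> pverts \<Gamma> \<and> u \<noteq> v}"
  shows "digraph_iso (with_proj \<Gamma>) (with_proj (complete_graph (card (pverts \<Gamma>))))"
proof -
  obtain h where h: "bij_betw h (pverts \<Gamma>) {0..<card (pverts \<Gamma>)}"
    using ex_bij_betw_finite_nat[OF fin] by blast
  \<comment> \<open>Arcs are ordered pairs, so the vertex bijection \<open>h\<close> determines the
    arc map.\<close>
  define f where "f = \<lparr> iso_verts = h, iso_arcs = map_prod h h, iso_head = snd, iso_tail = fst \<rparr>"
  have img: "h ` pverts \<Gamma> = {0..<card (pverts \<Gamma>)}" and inj: "inj_on h (pverts \<Gamma>)"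
    using h by (simp_all add: bij_betw_def)
  have "wf_digraph (with_proj \<Gamma>)"
    by (rule wf_digraph.intro) (simp_all add: arcs case_prod_beta)
  moreover have "inj_on (map_prod h h) (parcs \<Gamma>)"
    using inj arcs by (auto simp: inj_on_def)
  ultimately have "pre_digraph.digraph_isomorphism (with_proj \<Gamma>) f"
    using inj by (simp add: pre_digraph.digraph_isomorphism_def f_def)
  moreover have "map_prod h h ` parcs \<Gamma>
      = {(u, v). u \<in> h ` pverts \<Gamma> \<and> v \<in> h ` pverts \<Gamma> \<and> u \<noteq> v}"
    (is "_ = ?R")
  proof
    show "map_prod h h ` parcs \<Gamma> \<subseteq> ?R"
      using inj unfolding arcs by (auto simp: inj_on_def)
    show "?R \<subseteq> map_prod h h ` parcs \<Gamma>"
      unfolding arcs by auto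
  qed
  then have "with_proj (complete_graph (card (pverts \<Gamma>))) = app_iso f (with_proj \<Gamma>)"
    by (simp add: app_iso_def f_def complete_graph_def with_proj_def img)
  ultimately show ?thesis unfolding digraph_iso_def by blast
qed

text \<open>Every closed neighborhood is the whole vertex set, so any bijective labeling has
  constant sums.\<close>

lemma closed_distance_magic_of_iso_complete_graph:
  fixes \<Gamma> :: "'a pair_pre_digraph"
  assumes iso: "digraph_iso (with_proj \<Gamma>) (with_proj (complete_graph n))" and n: "n > 0"
  shows "closed_distance_magic (with_proj \<Gamma>)"
proof -
  obtain f where f: "pre_digraph.digraph_isomorphism (with_proj \<Gamma>) f"
    and eq: "with_proj (complete_graph n) = app_iso f (with_proj \<Gamma>)"
    using iso by (auto simp: digraph_iso_def)
  have inj: "inj_on (iso_verts f) (pverts \<Gamma>)"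
    using f by (simp add: pre_digraph.digraph_isomorphism_def)
  have wf: "wf_digraph (with_proj \<Gamma>)"
    using f by (simp add: pre_digraph.digraph_isomorphism_def)
  have verts: "iso_verts f ` pverts \<Gamma> = {0..<n}"
    using arg_cong[OF eq, of verts] by (simp add: complete_graph_def)
  have arcs: "iso_arcs f ` parcs \<Gamma> = {(u, v). u \<in> {0..<n} \<and> v \<in> {0..<n} \<and> u \<noteq> v}"
    using arg_cong[OF eq, of arcs] by (simp add: complete_graph_def)
  have ends: "iso_tail f = fst" "iso_head f = snd"
    using arg_cong[OF eq, of tail] arg_cong[OF eq, of head] by simp_all
  have bij: "bij_betw (iso_verts f) (pverts \<Gamma>) {0..<n}"
    using inj verts by (simp add: bij_betw_def)
  then have card: "card (pverts \<Gamma>) = n" using bij_betw_same_card by fastforce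
  have adj: "(u, v) \<in> parcs \<Gamma>" if uv: "u \<in> pverts \<Gamma>" "v \<in> pverts \<Gamma>" "u \<noteq> v" for u v
  proof -
    have "iso_verts f u \<noteq> iso_verts f v" using inj uv by (auto dest: inj_onD)
    then have "(iso_verts f u, iso_verts f v) \<in> iso_arcs f ` parcs \<Gamma>"
      unfolding arcs using verts uv by blast
    then obtain e where e: "e \<in> parcs \<Gamma>" "iso_arcs f e = (iso_verts f u, iso_verts f v)"
      by auto
    have "iso_verts f (fst e) = iso_verts f u" "iso_verts f (snd e) = iso_verts f v"
      using f e by (auto simp: pre_digraph.digraph_isomorphism_def ends)
    moreover have "fst e \<in> pverts \<Gamma>" "snd e \<in> pverts \<Gamma>"
      using wf_digraph.tail_in_verts[OF wf, of e] wf_digraph.head_in_verts[OF wf, of e] e(1)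
      by simp_all
    ultimately have "e = (u, v)" using inj uv by (metis inj_onD prod.collapse)
    then show ?thesis using e(1) by simp
  qed
  then have nbhd: "closed_neighborhood (with_proj \<Gamma>) u = pverts \<Gamma>" if "u \<in> pverts \<Gamma>" for u
    using that by (auto simp: closed_neighborhood_def arcs_ends_def image_iff)
  \<comment> \<open>Vertices of \<open>complete_graph n\<close> are numbered from 0, labels from
    1.\<close>
  define l where "l u = Suc (iso_verts f u)" for u
  have "bij_betw Suc {0..<n} {1..n}"
    by (intro bij_betw_byWitness[where f' = "\<lambda>k. k - 1"]) auto
  with bij have "bij_betw (Suc \<circ> iso_verts f) (pverts \<Gamma>) {1..n}" by (rule bij_betw_trans)
  then have "bij_betw l (pverts \<Gamma>) {1..n}" by (simp add: l_def[abs_def] comp_def)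
  moreover have "(\<Sum>u\<in>pverts \<Gamma>. l u) > 0"
    using n card by (intro sum_pos) (auto simp: l_def card_gt_0_iff)
  ultimately show ?thesis
    unfolding closed_distance_magic_def closed_distance_magic_labeling_def
    using nbhd card by auto
qed

section \<open>Completeness of closed distance magic circulants\<close>

lemma (in group) carrier_eq_of_closed_distance_magic_cayley_graph:
  assumes cyc: "cyclic_group G" "finite (carrier G)" and conn_set: "connection_set G S"
    and valency: "card S = 3 \<or> card S = 4"
    and connected: "connected (with_proj (cayley_graph G S))"
    and magic: "closed_distance_magic (with_proj (cayley_graph G S))"
  shows "carrier G = insert \<one> S"
proof -
  interpret comm_group G using cyc(1) by (rule cyclic_imp_abelian_group)
  define n where "n = card (carrier G)"
  have SG: "S \<subseteq> carrier G" and S1: "\<one> \<notin> S"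
    using conn_set by (auto simp: connection_set_def)
  have finS: "finite S" using finite_subset[OF SG cyc(2)] .
  from magic obtain l r where bij: "bij_betw l (carrier G) {1..n}"
    and nbhd: "\<And>u. u \<in> carrier G \<Longrightarrow> (\<Sum>x\<in>closed_neighborhood (with_proj (cayley_graph G S)) u. l x) = r"
    by (auto simp: closed_distance_magic_def closed_distance_magic_labeling_def
        cayley_graph_def n_def)
  have sum: "(\<Sum>s\<in>insert \<one> S. l (u \<otimes> s)) = r" if "u \<in> carrier G" for u
    using nbhd[OF that] sum_closed_neighborhood_cayley_graph[OF group_axioms SG that, of l]
    by simp
  then have sumS: "l u + (\<Sum>s\<in>S. l (u \<otimes> s)) = r" if "u \<in> carrier G" for u
    using that finS S1 by simp
  have inj: "inj_on l (carrier G)" using bij by (rule bij_betw_imp_inj_on)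
  have exponent: "s [^] Suc (card S) = \<one>" if s: "s \<in> S" for s
    using valency
  proof
    assume S3: "card S = 3"
    obtain a h where S: "S = {a, inv a, h}" "h \<otimes> h = \<one>"
      using connection_set_card_3[OF cyc conn_set S3] .
    then have distinct: "a \<noteq> inv a" "a \<noteq> h" "inv a \<noteq> h"
      using S3 by (auto simp: card_insert_if split: if_splits)
    have aG: "a \<in> carrier G" "h \<in> carrier G" using S SG by auto
    have "a [^] (4::nat) = \<one>"
    proof (rule pow_4_of_valency_3_sum[OF cyc inj aG(1,2) S(2)])
      show "l u + l (u \<otimes> a) + l (u \<otimes> inv a) + l (u \<otimes> h) = r" if "u \<in> carrier G" for u
        using sumS[OF that] distinct by (simp add: S(1))
    qed
    moreover have "h [^] (4::nat) = \<one>"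
      using S(2) aG by (simp add: numeral_eq_Suc m_assoc)
    ultimately show ?thesis
      using s aG unfolding S3 by (auto simp: S(1) nat_pow_inv)
  next
    assume S4: "card S = 4"
    \<comment> \<open>Double counting yields 2 r = 5 (n + 1), and parity then makes \<open>n\<close>
      odd.\<close>
    have "n * r = card (insert \<one> S) * (\<Sum>u\<in>carrier G. l u)"
      unfolding n_def by (rule constant_translate_sum) (use cyc SG sum in auto)
    moreover have "(\<Sum>u\<in>carrier G. l u) = \<Sum>{1..n}"
      using sum.reindex_bij_betw[OF bij, of "\<lambda>x. x"] by simp
    ultimately have "n * (2 * r) = 5 * (2 * \<Sum>{1..n})"
      using S4 finS S1 by simp
    also have "2 * \<Sum>{1..n} = n * (n + 1)"
      using double_gauss_sum_from_Suc_0[of n, where 'a = nat] by simp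
    finally have "n * (2 * r) = n * (5 * (n + 1))" by (simp add: algebra_simps)
    moreover have "n > 0" unfolding n_def using cyc(2) one_closed by (auto simp: card_gt_0_iff)
    ultimately have mean: "2 * r = 5 * (n + 1)" by simp
    then have "odd n" by presburger
    \<comment> \<open>A group of odd order contains no involution.\<close>
    have "s \<otimes> s \<noteq> \<one>" if "s \<in> S" for s
    proof
      assume "s \<otimes> s = \<one>"
      have sG: "s \<in> carrier G" using that SG by blast
      have "s [^] n = \<one>" using pow_order_eq_1[OF sG] by (simp add: n_def Coset.order_def)
      moreover obtain k where "n = Suc (2 * k)" using \<open>odd n\<close> by (auto elim: oddE)
      moreover have "s [^] (2 * k) = (s \<otimes> s) [^] k"
        using sG by (simp add: pow_mult_distrib nat_pow_mult mult_2)
      ultimately have "s = \<one>" using \<open>s \<otimes> s = \<one>\<close> sG by simp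
      with that S1 show False by blast
    qed
    then obtain a b where S: "S = {a, inv a, b, inv b}"
      using connection_set_card_4[OF conn_set S4] by blast
    then have distinct: "a \<noteq> inv a" "a \<noteq> b" "a \<noteq> inv b" "inv a \<noteq> b" "inv a \<noteq> inv b" "b \<noteq> inv b"
      using S4 by (auto simp: card_insert_if split: if_splits)
    have abG: "a \<in> carrier G" "b \<in> carrier G" using S SG by auto
    have "l u + l (u \<otimes> a) + l (u \<otimes> inv a) + l (u \<otimes> b) + l (u \<otimes> inv b) = r"
      if "u \<in> carrier G" for u
      using sumS[OF that] distinct by (simp add: S)
    then have "a [^] (5::nat) = \<one>" "b [^] (5::nat) = \<one>"
      using pow_5_of_valency_4_sum[OF cyc _ inj abG, of r]
        pow_5_of_valency_4_sum[OF cyc _ inj abG(2,1), of r] \<open>odd n\<close> mean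
      by (simp_all add: n_def add_ac)
    then show ?thesis
      using s abG unfolding S4 by (auto simp: S nat_pow_inv)
  qed
  \<comment> \<open>The subset \<open>insert \<one> S\<close> already has
    \<open>Suc (card S)\<close> elements, so this bound forces equality.\<close>
  have "card (carrier G) \<le> Suc (card S)"
  proof (rule card_cyclic_le_exponent[OF cyc])
    show "x [^] Suc (card S) = \<one>" if "x \<in> carrier G" for x
      using pow_eq_one_of_connected_cayley_graph[OF conn_set exponent connected] that
      by blast
  qed simp
  then show ?thesis
    using finS S1 SG cyc(2) by (intro card_seteq[symmetric]) auto
qed

text \<open>Distinct \<open>u\<close> and \<open>v\<close> differ by the nontrivial element
  \<open>inv u \<otimes> v\<close>, which must lie in \<open>S\<close>.\<close>

lemma (in group) parcs_cayley_graph_complete: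
  assumes carrier: "carrier G = insert \<one> S" and S1: "\<one> \<notin> S"
  shows "parcs (cayley_graph G S) = {(u, v). u \<in> carrier G \<and> v \<in> carrier G \<and> u \<noteq> v}"
proof -
  have "(\<exists>s\<in>S. v = u \<otimes> s) \<longleftrightarrow> u \<noteq> v" if uv: "u \<in> carrier G" "v \<in> carrier G" for u v
  proof
    assume "\<exists>s\<in>S. v = u \<otimes> s"
    then obtain s where "s \<in> S" "v = u \<otimes> s" ..
    then show "u \<noteq> v" using uv S1 carrier l_cancel_one'[of u s] by auto
  next
    assume "u \<noteq> v"
    then have "inv u \<otimes> v \<noteq> \<one>" using uv inv_equality[of "inv u" v] by auto
    then have "inv u \<otimes> v \<in> S" using uv carrier by blast
    moreover have "v = u \<otimes> (inv u \<otimes> v)" using uv by (simp flip: m_assoc)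
    ultimately show "\<exists>s\<in>S. v = u \<otimes> s" by blast
  qed
  then show ?thesis by (auto simp: cayley_graph_def)
qed

theorem theorem1p1:
  fixes G :: "('a, 'm) monoid_scheme" and S :: "'a set" and \<Gamma> :: "'a pair_pre_digraph"
  assumes "group G" and "cyclic_group G" and "finite (carrier G)"
    and "connection_set G S"
    and "\<Gamma> = cayley_graph G S"
    and "card S = 3 \<or> card S = 4"
    and "connected (with_proj \<Gamma>)"
  shows "closed_distance_magic (with_proj \<Gamma>) \<longleftrightarrow>
    digraph_iso (with_proj \<Gamma>) (with_proj (complete_graph 4)) \<or>
    digraph_iso (with_proj \<Gamma>) (with_proj (complete_graph 5))"
proof
  assume "digraph_iso (with_proj \<Gamma>) (with_proj (complete_graph 4)) \<or>
    digraph_iso (with_proj \<Gamma>) (with_proj (complete_graph 5))"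
  then show "closed_distance_magic (with_proj \<Gamma>)"
    using closed_distance_magic_of_iso_complete_graph by fastforce
next
  interpret group G by fact
  assume "closed_distance_magic (with_proj \<Gamma>)"
  then have carrier: "carrier G = insert \<one>\<^bsub>G\<^esub> S"
    using assms carrier_eq_of_closed_distance_magic_cayley_graph by blast
  have S1: "\<one>\<^bsub>G\<^esub> \<notin> S" using assms(4) by (simp add: connection_set_def)
  have verts: "pverts \<Gamma> = carrier G" by (simp add: assms(5) cayley_graph_def)
  have "digraph_iso (with_proj \<Gamma>) (with_proj (complete_graph (card (carrier G))))"
    using digraph_iso_complete_graph[of \<Gamma>] parcs_cayley_graph_complete[OF carrier S1] assms(3)
    by (simp add: verts) (simp add: assms(5))
  moreover have "card (carrier G) = Suc (card S)"
    using carrier S1 assms(3) by simp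
  ultimately show "digraph_iso (with_proj \<Gamma>) (with_proj (complete_graph 4)) \<or>
    digraph_iso (with_proj \<Gamma>) (with_proj (complete_graph 5))"
    using assms(6) by auto
qed

end
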